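(* Let $\Gamma$ be a simplicial complex (not assumed Cohen-Macaulay) of dimension $d-1$ with $n>24d+3$ vertices. Then $\Gamma$ satisfies the Taylor lower bound conjecture without equality, that is, $$f_{d-1}(\Gamma)>\frac{1}{(n-d)!}\prod_{i=1}^{n-d}\tilde m_i(\Gamma).$$
   Context: A simplicial complex $\Gamma$ on $[n]=\{1,\dots,n\}$ is a collection of subsets (faces) closed under inclusion and containing all singletons; a face $F$ has dimension $|F|-1$, the dimension of $\Gamma$ is the largest dimension of a face, and $f_{d-1}(\Gamma)$ is the number of faces of dimension $d-1$. $I_\Gamma\subset\mathbf{k}[x_1,\dots,x_n]$ ($\mathbf{k}$ a field) is the Stanley-Reisner ideal, generated by the squarefree monomials corresponding to non-faces; it has codimension $n-d$ and its quotient has multiplicity $f_{d-1}(\Gamma)$. $\mathrm{GEN}(I_\Gamma)$ is the set of minimal monomial generators of $I_\Gamma$, and $\tilde m_i(\Gamma)=\min\{\deg\operatorname{lcm}(T):T\subset\mathrm{GEN}(I_\Gamma),\ |T|=i\}$ is the $i$-th minimal shift of the Taylor resolution. *)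

theory Defs
  imports Complex_Main "HOL-Algebra.Ideal" "HOL-Library.Poly_Mapping"
begin

section \<open>Simplicial complexes\<close>

definition simplicial_complex_on :: "nat \<Rightarrow> nat set set \<Rightarrow> bool" where
  "simplicial_complex_on n \<Gamma> \<longleftrightarrow>
     (\<forall>F\<in>\<Gamma>. F \<subseteq> {1..n}) \<and>
     (\<forall>F\<in>\<Gamma>. \<forall>G. G \<subseteq> F \<longrightarrow> G \<in> \<Gamma>) \<and>
     (\<forall>i\<in>{1..n}. {i} \<in> \<Gamma>)"

text \<open>Dimensions are integers because the empty face has dimension \<open>-1\<close>.\<close>

definition face_dim :: "nat set \<Rightarrow> int" where
  "face_dim F = int (card F) - 1"

definition complex_dim :: "nat set set \<Rightarrow> int" where
  "complex_dim \<Gamma> = Max (face_dim ` \<Gamma>)"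

definition face_number :: "int \<Rightarrow> nat set set \<Rightarrow> nat" where
  "face_number k \<Gamma> = card {F \<in> \<Gamma>. face_dim F = k}"


section \<open>The polynomial ring and its monomials\<close>

text \<open>A finitely supported function \<open>a\<close> on \<open>nat\<close> is the exponent vector of a monomial, and a
  finitely supported function on exponent vectors is a polynomial. The multiplication of
  \<^type>\<open>poly_mapping\<close> is convolution, hence polynomial multiplication.\<close>

type_synonym expo = "nat \<Rightarrow>\<^sub>0 nat"
type_synonym 'k poly_nat = "expo \<Rightarrow>\<^sub>0 'k"

definition expos :: "nat \<Rightarrow> expo set" where
  "expos n = {a. Poly_Mapping.keys a \<subseteq> {1..n}}"

definition poly_ring :: "nat \<Rightarrow> ('k::field) poly_nat ring" where
  "poly_ring n =
     \<lparr>carrier = {p. Poly_Mapping.keys p \<subseteq> expos n}, monoid.mult = (*), one = 1, ring.zero = 0, add = (+)\<rparr>"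

definition monomial :: "expo \<Rightarrow> ('k::field) poly_nat" where
  "monomial a = Poly_Mapping.single a 1"

definition expo_deg :: "expo \<Rightarrow> nat" where
  "expo_deg a = (\<Sum>i\<in>Poly_Mapping.keys a. Poly_Mapping.lookup a i)"

text \<open>The exponent vector of the least common multiple of a finite set of monomials; inserting
  \<open>0\<close> makes the least common multiple of the empty set the monomial \<open>1\<close>. The lemma \<open>expo_lcm_dvd_iff\<close> below
  is the universal property.\<close>

definition expo_lcm :: "expo set \<Rightarrow> expo" where
  "expo_lcm T = Abs_poly_mapping (\<lambda>i. Max (insert 0 ((\<lambda>a. Poly_Mapping.lookup a i) ` T)))"


section \<open>Stanley-Reisner ideal and minimal Taylor shifts\<close>

definition squarefree_expo :: "nat set \<Rightarrow> expo" where
  "squarefree_expo F = (\<Sum>i\<in>F. Poly_Mapping.single i 1)"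

definition stanley_reisner_ideal :: "nat \<Rightarrow> nat set set \<Rightarrow> ('k::field) poly_nat set" where
  "stanley_reisner_ideal n \<Gamma> =
     Idl\<^bsub>poly_ring n\<^esub> {monomial (squarefree_expo F) | F. F \<subseteq> {1..n} \<and> F \<notin> \<Gamma>}"

definition minimal_monomial_generating_set ::
    "nat \<Rightarrow> ('k::field) poly_nat set \<Rightarrow> expo set \<Rightarrow> bool" where
  "minimal_monomial_generating_set n I G \<longleftrightarrow>
     G \<subseteq> expos n \<and> Idl\<^bsub>poly_ring n\<^esub> (monomial ` G) = I \<and>
     (\<forall>G'. G' \<subset> G \<longrightarrow> Idl\<^bsub>poly_ring n\<^esub> (monomial ` G') \<noteq> I)"

text \<open>Monomial generators are represented by their exponent vectors. For a monomial ideal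
  the minimal generating set exists and is unique, see
  \<open>ex1_minimal_monomial_generating_set\<close> below.\<close>

definition GEN :: "nat \<Rightarrow> ('k::field) poly_nat set \<Rightarrow> expo set" where
  "GEN n I = (THE G. minimal_monomial_generating_set n I G)"

text \<open>The minimum is only meaningful for \<open>i \<le> card (GEN n I)\<close>. This holds whenever \<open>i\<close> is at most
  the codimension of \<open>I\<close>.\<close>

definition taylor_min_shift :: "nat \<Rightarrow> ('k::field) poly_nat set \<Rightarrow> nat \<Rightarrow> nat" where
  "taylor_min_shift n I i = Min {expo_deg (expo_lcm T) | T. T \<subseteq> GEN n I \<and> card T = i}"


section \<open>Basic facts about these notions\<close>

definition expo_dvd :: "expo \<Rightarrow> expo \<Rightarrow> bool" where
  "expo_dvd a b \<longleftrightarrow> (\<exists>c. b = a + c)"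

lemma expo_dvd_iff: "expo_dvd a b \<longleftrightarrow> (\<forall>i. Poly_Mapping.lookup a i \<le> Poly_Mapping.lookup b i)"
proof
  assume "\<forall>i. Poly_Mapping.lookup a i \<le> Poly_Mapping.lookup b i"
  then have "b = a + (b - a)"
    by (intro poly_mapping_eqI) (simp add: lookup_add lookup_minus)
  then show "expo_dvd a b" unfolding expo_dvd_def by blast
qed (auto simp: expo_dvd_def lookup_add)

lemma expo_dvd_refl: "expo_dvd a a"
  by (simp add: expo_dvd_iff)

lemma expo_dvd_trans: "expo_dvd a b \<Longrightarrow> expo_dvd b c \<Longrightarrow> expo_dvd a c"
  unfolding expo_dvd_iff by (meson order_trans)

lemma expo_dvd_antisym: "expo_dvd a b \<Longrightarrow> expo_dvd b a \<Longrightarrow> a = b"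
  unfolding expo_dvd_iff by (intro poly_mapping_eqI) (simp add: order_antisym)

lemma lookup_expo_lcm:
  assumes "finite T"
  shows "Poly_Mapping.lookup (expo_lcm T) i = Max (insert 0 ((\<lambda>a. Poly_Mapping.lookup a i) ` T))"
proof -
  have "{i. Max (insert 0 ((\<lambda>a. Poly_Mapping.lookup a i) ` T)) \<noteq> 0} \<subseteq> (\<Union>a\<in>T. Poly_Mapping.keys a)"
  proof
    fix i assume "i \<in> {i. Max (insert 0 ((\<lambda>a. Poly_Mapping.lookup a i) ` T)) \<noteq> 0}"
    moreover have "Max (insert 0 ((\<lambda>a. Poly_Mapping.lookup a i) ` T)) \<in> insert 0 ((\<lambda>a. Poly_Mapping.lookup a i) ` T)"
      using assms by (intro Max_in) auto
    ultimately show "i \<in> (\<Union>a\<in>T. Poly_Mapping.keys a)"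
      by (auto simp: in_keys_iff)
  qed
  then have "finite {i. Max (insert 0 ((\<lambda>a. Poly_Mapping.lookup a i) ` T)) \<noteq> 0}"
    by (rule finite_subset) (use assms in auto)
  then show ?thesis
    by (simp add: expo_lcm_def)
qed

lemma expo_lcm_dvd_iff:
  assumes "finite T"
  shows "expo_dvd (expo_lcm T) c \<longleftrightarrow> (\<forall>a\<in>T. expo_dvd a c)"
  using assms by (auto simp: expo_dvd_iff lookup_expo_lcm)

lemma zero_in_expos: "0 \<in> expos n"
  by (simp add: expos_def)

lemma expos_add: "a \<in> expos n \<Longrightarrow> b \<in> expos n \<Longrightarrow> a + b \<in> expos n"
  unfolding expos_def using keys_add[of a b] by blast

lemma expos_dvd: "b \<in> expos n \<Longrightarrow> expo_dvd a b \<Longrightarrow> a \<in> expos n"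
  unfolding expos_def expo_dvd_iff
  by (auto simp: in_keys_iff subset_iff) (metis le_zero_eq less_one not_le)+

lemma poly_ring_simps [simp]:
  "p \<in> carrier (poly_ring n) \<longleftrightarrow> Poly_Mapping.keys p \<subseteq> expos n"
  "p \<otimes>\<^bsub>poly_ring n\<^esub> q = p * q" "p \<oplus>\<^bsub>poly_ring n\<^esub> q = p + q"
  "\<one>\<^bsub>poly_ring n\<^esub> = 1" "\<zero>\<^bsub>poly_ring n\<^esub> = 0"
  by (simp_all add: poly_ring_def)

lemma keys_mult_expos:
  assumes "Poly_Mapping.keys p \<subseteq> expos n" "Poly_Mapping.keys q \<subseteq> expos n"
  shows "Poly_Mapping.keys (p * q) \<subseteq> expos n"
  using keys_mult[of p q] assms expos_add by blast

lemma cring_poly_ring: "cring (poly_ring n :: ('k::field) poly_nat ring)"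
proof (rule cringI)
  show "abelian_group (poly_ring n :: 'k poly_nat ring)"
  proof (rule abelian_groupI)
    fix p :: "'k poly_nat" assume "p \<in> carrier (poly_ring n)"
    then show "\<exists>q\<in>carrier (poly_ring n). q \<oplus>\<^bsub>poly_ring n\<^esub> p = \<zero>\<^bsub>poly_ring n\<^esub>"
      by (intro bexI[of _ "- p"]) auto
  next
    fix p q :: "'k poly_nat"
    assume "p \<in> carrier (poly_ring n)" "q \<in> carrier (poly_ring n)"
    then show "p \<oplus>\<^bsub>poly_ring n\<^esub> q \<in> carrier (poly_ring n)"
      using keys_add[of p q] by auto
  qed (auto simp: algebra_simps)
  show "comm_monoid (poly_ring n :: 'k poly_nat ring)"
  proof (rule comm_monoidI)
    fix p q :: "'k poly_nat"
    assume "p \<in> carrier (poly_ring n)" "q \<in> carrier (poly_ring n)"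
    then show "p \<otimes>\<^bsub>poly_ring n\<^esub> q \<in> carrier (poly_ring n)"
      using keys_mult_expos[of p n q] by simp
  qed (auto simp: algebra_simps zero_in_expos)
qed (auto simp: algebra_simps)

lemma poly_ring_a_inv:
  fixes p :: "('k::field) poly_nat"
  assumes "Poly_Mapping.keys p \<subseteq> expos n"
  shows "\<ominus>\<^bsub>poly_ring n\<^esub> p = - p"
proof -
  interpret cring "poly_ring n :: 'k poly_nat ring" by (rule cring_poly_ring)
  show ?thesis
    by (rule minus_equality) (use assms in auto)
qed

lemma poly_sum_terms:
  fixes p :: "('k::field) poly_nat"
  shows "p = (\<Sum>b\<in>Poly_Mapping.keys p. Poly_Mapping.single b (Poly_Mapping.lookup p b))"
proof (rule poly_mapping_eqI)
  fix a
  show "Poly_Mapping.lookup p a = Poly_Mapping.lookup (\<Sum>b\<in>Poly_Mapping.keys p. Poly_Mapping.single b (Poly_Mapping.lookup p b)) a"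
    by (auto simp: lookup_sum lookup_single when_def sum.delta in_keys_iff)
qed

lemma monomial_span_ideal:
  fixes n :: nat and A :: "expo set"
  shows "ideal {p. Poly_Mapping.keys p \<subseteq> expos n \<and> (\<forall>b\<in>Poly_Mapping.keys p. \<exists>a\<in>A. expo_dvd a b)}
           (poly_ring n :: ('k::field) poly_nat ring)" (is "ideal ?J _")
proof -
  interpret cring "poly_ring n :: 'k poly_nat ring" by (rule cring_poly_ring)
  have mult: "q * p \<in> ?J" if "p \<in> ?J" "Poly_Mapping.keys q \<subseteq> expos n" for p q :: "'k poly_nat"
  proof -
    have "\<exists>a\<in>A. expo_dvd a b" if b: "b \<in> Poly_Mapping.keys (q * p)" for b
    proof -
      obtain u v where uv: "b = u + v" "v \<in> Poly_Mapping.keys p"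
        using b keys_mult[of q p] by blast
      then obtain a where "a \<in> A" "expo_dvd a v" using \<open>p \<in> ?J\<close> by blast
      then show ?thesis using uv by (auto simp: expo_dvd_iff lookup_add intro: trans_le_add2)
    qed
    then show ?thesis using that keys_mult_expos by blast
  qed
  show ?thesis
  proof (rule idealI)
    show "ring (poly_ring n :: 'k poly_nat ring)" by (rule ring_axioms)
    show "subgroup ?J (add_monoid (poly_ring n :: 'k poly_nat ring))"
    proof
      fix p q :: "'k poly_nat" assume "p \<in> ?J" "q \<in> ?J"
      then show "p \<otimes>\<^bsub>add_monoid (poly_ring n)\<^esub> q \<in> ?J"
        using keys_add[of p q] by auto
    next
      fix p :: "'k poly_nat" assume "p \<in> ?J"
      then show "inv\<^bsub>add_monoid (poly_ring n)\<^esub> p \<in> ?J"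
        using poly_ring_a_inv[of p n] by (auto simp: a_inv_def)
    qed auto
  qed (use mult in \<open>auto simp: mult.commute\<close>)
qed

lemma genideal_monomials:
  fixes A :: "expo set"
  assumes A: "A \<subseteq> expos n"
  shows "Idl\<^bsub>poly_ring n\<^esub> (monomial ` A :: ('k::field) poly_nat set) =
           {p. Poly_Mapping.keys p \<subseteq> expos n \<and> (\<forall>b\<in>Poly_Mapping.keys p. \<exists>a\<in>A. expo_dvd a b)}" (is "?I = ?J")
proof
  interpret cring "poly_ring n :: 'k poly_nat ring" by (rule cring_poly_ring)
  have sub: "(monomial ` A :: 'k poly_nat set) \<subseteq> carrier (poly_ring n)"
    using A by (auto simp: monomial_def)
  show "?I \<subseteq> ?J"
    by (rule genideal_minimal[OF monomial_span_ideal])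
      (use A in \<open>auto simp: monomial_def intro: expo_dvd_refl\<close>)
  interpret I: ideal ?I "poly_ring n :: 'k poly_nat ring"
    by (rule genideal_ideal[OF sub])
  show "?J \<subseteq> ?I"
  proof
    fix p assume p: "p \<in> ?J"
    have terms: "Poly_Mapping.single b (Poly_Mapping.lookup p b) \<in> ?I" if b: "b \<in> Poly_Mapping.keys p" for b
    proof -
      obtain a c where a: "a \<in> A" "b = a + c"
        using p b unfolding expo_dvd_def by blast
      have bn: "b \<in> expos n" using p b by blast
      have "c \<in> expos n"
        by (rule expos_dvd[OF bn]) (simp add: a expo_dvd_iff lookup_add)
      then have "Poly_Mapping.single c (Poly_Mapping.lookup p b) \<in> carrier (poly_ring n)" by auto
      moreover have "monomial a \<in> ?I" using a genideal_self[OF sub] by blast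
      ultimately have "Poly_Mapping.single c (Poly_Mapping.lookup p b) * monomial a \<in> ?I"
        using I.I_l_closed by fastforce
      then show ?thesis by (simp add: monomial_def mult_single a add.commute)
    qed
    have sums: "(\<Sum>b\<in>B. Poly_Mapping.single b (Poly_Mapping.lookup p b)) \<in> ?I"
      if "finite B" "\<And>b. b \<in> B \<Longrightarrow> Poly_Mapping.single b (Poly_Mapping.lookup p b) \<in> ?I" for B
      using that
    proof (induction B rule: finite_induct)
      case empty
      then show ?case using I.zero_closed by simp
    next
      case (insert b B)
      then show ?case using I.a_closed[of "Poly_Mapping.single b (Poly_Mapping.lookup p b)"] by simp
    qed
    have "(\<Sum>b\<in>Poly_Mapping.keys p. Poly_Mapping.single b (Poly_Mapping.lookup p b)) \<in> ?I"
      by (rule sums[OF finite_keys terms])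
    then show "p \<in> ?I" by (simp only: poly_sum_terms[of p, symmetric])
  qed
qed

lemma monomial_in_genideal_iff:
  assumes "A \<subseteq> expos n"
  shows "monomial b \<in> Idl\<^bsub>poly_ring n\<^esub> (monomial ` A :: ('k::field) poly_nat set) \<longleftrightarrow>
           b \<in> expos n \<and> (\<exists>a\<in>A. expo_dvd a b)"
  unfolding genideal_monomials[OF assms] by (auto simp: monomial_def)

lemma expo_deg_expos:
  assumes "a \<in> expos n"
  shows "expo_deg a = (\<Sum>i\<in>{1..n}. Poly_Mapping.lookup a i)"
  unfolding expo_deg_def using assms
  by (intro sum.mono_neutral_left) (auto simp: expos_def in_keys_iff)

lemma expo_dvd_deg_less:
  assumes "b \<in> expos n" "expo_dvd a b" "a \<noteq> b"
  shows "expo_deg a < expo_deg b"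
proof -
  have a: "a \<in> expos n" using assms expos_dvd by blast
  obtain i where i: "Poly_Mapping.lookup a i \<noteq> Poly_Mapping.lookup b i" using assms by (metis poly_mapping_eqI)
  then have "i \<in> Poly_Mapping.keys a \<union> Poly_Mapping.keys b"
    by (auto simp: in_keys_iff)
  then have "i \<in> {1..n}" using a assms(1) unfolding expos_def by blast
  moreover have "Poly_Mapping.lookup a i < Poly_Mapping.lookup b i"
    using i assms(2) by (simp add: expo_dvd_iff order.strict_iff_order)
  ultimately show ?thesis
    unfolding expo_deg_expos[OF a] expo_deg_expos[OF assms(1)]
    using assms(2) by (intro sum_strict_mono_ex1) (auto simp: expo_dvd_iff)
qed

definition minimal_expos :: "expo set \<Rightarrow> expo set" where
  "minimal_expos A = {a \<in> A. \<forall>b\<in>A. expo_dvd b a \<longrightarrow> b = a}"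

lemma ex_minimal_expo:
  assumes "A \<subseteq> expos n" "b \<in> A"
  shows "\<exists>a\<in>minimal_expos A. expo_dvd a b"
  using assms(2)
proof (induction "expo_deg b" arbitrary: b rule: less_induct)
  case less
  show ?case
  proof (cases "b \<in> minimal_expos A")
    case True
    then show ?thesis using expo_dvd_refl by blast
  next
    case False
    then obtain c where "c \<in> A" "expo_dvd c b" "c \<noteq> b"
      using less.prems by (auto simp: minimal_expos_def)
    moreover have "expo_deg c < expo_deg b"
      using calculation less.prems assms(1) expo_dvd_deg_less by blast
    ultimately show ?thesis using less.hyps expo_dvd_trans by blast
  qed
qed

lemma genideal_minimal_expos:
  assumes "A \<subseteq> expos n"
  shows "Idl\<^bsub>poly_ring n\<^esub> (monomial ` minimal_expos A :: ('k::field) poly_nat set) =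
           Idl\<^bsub>poly_ring n\<^esub> (monomial ` A)"
proof -
  have sub: "minimal_expos A \<subseteq> A" by (auto simp: minimal_expos_def)
  have "(\<exists>a\<in>minimal_expos A. expo_dvd a b) \<longleftrightarrow> (\<exists>a\<in>A. expo_dvd a b)" for b
    using sub ex_minimal_expo[OF assms] expo_dvd_trans by blast
  then show ?thesis
    using genideal_monomials[OF assms, where 'k='k]
      genideal_monomials[OF subset_trans[OF sub assms], where 'k='k] by simp
qed

lemma minimal_expos_subset_generators:
  assumes A: "A \<subseteq> expos n" and G: "G \<subseteq> expos n"
    and eq: "Idl\<^bsub>poly_ring n\<^esub> (monomial ` G :: ('k::field) poly_nat set) =
               Idl\<^bsub>poly_ring n\<^esub> (monomial ` A)"
  shows "minimal_expos A \<subseteq> G"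
proof
  fix a assume a: "a \<in> minimal_expos A"
  have iff: "(\<exists>c\<in>G. expo_dvd c b) \<longleftrightarrow> (\<exists>c\<in>A. expo_dvd c b)" if "b \<in> expos n" for b
    using monomial_in_genideal_iff[OF A, of b, where 'k='k]
      monomial_in_genideal_iff[OF G, of b, where 'k='k] eq that by simp
  have aA: "a \<in> A" "a \<in> expos n" using a A by (auto simp: minimal_expos_def)
  then obtain g where g: "g \<in> G" "expo_dvd g a" using iff expo_dvd_refl by blast
  then obtain c where c: "c \<in> A" "expo_dvd c g" using iff[of g] G expo_dvd_refl by blast
  then have "c = a" using a g expo_dvd_trans by (auto simp: minimal_expos_def)
  then show "a \<in> G" using c g expo_dvd_antisym by blast
qed

lemma minimal_monomial_generating_set_iff:
  assumes A: "A \<subseteq> expos n"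
  shows "minimal_monomial_generating_set n
           (Idl\<^bsub>poly_ring n\<^esub> (monomial ` A) :: ('k::field) poly_nat set) G \<longleftrightarrow> G = minimal_expos A"
proof -
  have sub: "minimal_expos A \<subseteq> expos n" using A by (auto simp: minimal_expos_def)
  let ?I = "\<lambda>B. Idl\<^bsub>poly_ring n\<^esub> (monomial ` B) :: 'k poly_nat set"
  have gen: "?I (minimal_expos A) = ?I A" by (rule genideal_minimal_expos[OF A])
  have least: "minimal_expos A \<subseteq> G" if "G \<subseteq> expos n" "?I G = ?I A" for G
    by (rule minimal_expos_subset_generators[OF A that])
  show ?thesis
  proof
    assume "minimal_monomial_generating_set n (?I A) G"
    then have G: "G \<subseteq> expos n" "?I G = ?I A" "\<And>G'. G' \<subset> G \<Longrightarrow> ?I G' \<noteq> ?I A"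
      by (auto simp: minimal_monomial_generating_set_def)
    show "G = minimal_expos A"
      using least[OF G(1,2)] G(3)[of "minimal_expos A"] gen by blast
  next
    assume G: "G = minimal_expos A"
    have "?I G' \<noteq> ?I A" if "G' \<subset> G" for G'
      using least[of G'] that sub G by blast
    then show "minimal_monomial_generating_set n (?I A) G"
      using G sub gen by (simp add: minimal_monomial_generating_set_def)
  qed
qed

theorem ex1_minimal_monomial_generating_set:
  assumes "A \<subseteq> expos n"
  shows "\<exists>!G. minimal_monomial_generating_set n
           (Idl\<^bsub>poly_ring n\<^esub> (monomial ` A) :: ('k::field) poly_nat set) G"
  using minimal_monomial_generating_set_iff[OF assms, where 'k='k] by blast

lemma GEN_genideal:
  assumes "A \<subseteq> expos n"
  shows "GEN n (Idl\<^bsub>poly_ring n\<^esub> (monomial ` A) :: ('k::field) poly_nat set) = minimal_expos A"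
  unfolding GEN_def minimal_monomial_generating_set_iff[OF assms] by simp

lemma lookup_squarefree_expo:
  assumes "finite F"
  shows "Poly_Mapping.lookup (squarefree_expo F) i = (if i \<in> F then 1 else 0)"
  using assms by (auto simp: squarefree_expo_def lookup_sum lookup_single when_def sum.delta)

lemma squarefree_expo_dvd_iff:
  assumes "finite F" "finite G"
  shows "expo_dvd (squarefree_expo F) (squarefree_expo G) \<longleftrightarrow> F \<subseteq> G"
  using assms by (auto simp: expo_dvd_iff lookup_squarefree_expo)

theorem GEN_stanley_reisner_ideal:
  "GEN n (stanley_reisner_ideal n \<Gamma> :: ('k::field) poly_nat set) =
     squarefree_expo ` {F. F \<subseteq> {1..n} \<and> F \<notin> \<Gamma> \<and> (\<forall>G. G \<subset> F \<longrightarrow> G \<in> \<Gamma>)}"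
proof -
  let ?N = "{F. F \<subseteq> {1..n} \<and> F \<notin> \<Gamma>}"
  have fin: "finite F" if "F \<in> ?N" for F
    using that finite_subset by auto
  have sub: "squarefree_expo ` ?N \<subseteq> expos n"
  proof
    fix a assume "a \<in> squarefree_expo ` ?N"
    then obtain F where F: "F \<in> ?N" "a = squarefree_expo F" by blast
    have "Poly_Mapping.keys a \<subseteq> F"
      using F(2) lookup_squarefree_expo[OF fin[OF F(1)]]
      by (auto simp: in_keys_iff split: if_splits)
    then show "a \<in> expos n" using F(1) by (auto simp: expos_def)
  qed
  have "stanley_reisner_ideal n \<Gamma> =
          Idl\<^bsub>poly_ring n\<^esub> (monomial ` squarefree_expo ` ?N :: 'k poly_nat set)"
    unfolding stanley_reisner_ideal_def by (rule arg_cong[where f = "genideal _"]) auto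
  then have "GEN n (stanley_reisner_ideal n \<Gamma> :: 'k poly_nat set) =
      minimal_expos (squarefree_expo ` ?N)"
    using GEN_genideal[OF sub, where 'k='k] by simp
  also have "\<dots> = squarefree_expo ` {F \<in> ?N. \<forall>G\<in>?N. G \<subseteq> F \<longrightarrow> G = F}"
  proof -
    have dvd: "expo_dvd (squarefree_expo G) (squarefree_expo F) \<longleftrightarrow> G \<subseteq> F" if "F \<in> ?N" "G \<in> ?N" for F G
      using squarefree_expo_dvd_iff[OF fin[OF that(2)] fin[OF that(1)]] .
    have eq: "squarefree_expo G = squarefree_expo F \<longleftrightarrow> G = F" if "F \<in> ?N" "G \<in> ?N" for F G
    proof
      assume "squarefree_expo G = squarefree_expo F"
      then show "G = F" using dvd[OF that] dvd[OF that(2,1)] expo_dvd_refl by auto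
    qed simp
    have minimal: "squarefree_expo F \<in> minimal_expos (squarefree_expo ` ?N) \<longleftrightarrow>
            (\<forall>G\<in>?N. G \<subseteq> F \<longrightarrow> G = F)" if F: "F \<in> ?N" for F
    proof -
      have "squarefree_expo F \<in> minimal_expos (squarefree_expo ` ?N) \<longleftrightarrow>
          (\<forall>G\<in>?N. expo_dvd (squarefree_expo G) (squarefree_expo F) \<longrightarrow>
            squarefree_expo G = squarefree_expo F)"
        unfolding minimal_expos_def using F by blast
      also have "\<dots> \<longleftrightarrow> (\<forall>G\<in>?N. G \<subseteq> F \<longrightarrow> G = F)"
        by (intro ball_cong refl) (simp only: dvd[OF F] eq[OF F])
      finally show ?thesis .
    qed
    show ?thesis
    proof (intro subset_antisym subsetI)
      fix a assume a: "a \<in> minimal_expos (squarefree_expo ` ?N)"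
      then have "a \<in> squarefree_expo ` ?N" by (simp add: minimal_expos_def)
      then obtain F where F: "F \<in> ?N" "a = squarefree_expo F" by (rule imageE)
      then show "a \<in> squarefree_expo ` {F \<in> ?N. \<forall>G\<in>?N. G \<subseteq> F \<longrightarrow> G = F}"
        using a minimal[OF F(1)] by blast
    next
      fix a assume "a \<in> squarefree_expo ` {F \<in> ?N. \<forall>G\<in>?N. G \<subseteq> F \<longrightarrow> G = F}"
      then obtain F where F: "F \<in> {F \<in> ?N. \<forall>G\<in>?N. G \<subseteq> F \<longrightarrow> G = F}" "a = squarefree_expo F"
        by (rule imageE)
      then have "F \<in> ?N" by simp
      then show "a \<in> minimal_expos (squarefree_expo ` ?N)"
        using F minimal[of F] by simp
    qed
  qed
  also have "{F \<in> ?N. \<forall>G\<in>?N. G \<subseteq> F \<longrightarrow> G = F} =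
      {F. F \<subseteq> {1..n} \<and> F \<notin> \<Gamma> \<and> (\<forall>G. G \<subset> F \<longrightarrow> G \<in> \<Gamma>)}"
    by blast
  finally show ?thesis .
qed

end

theory Submission
  imports Defs
begin

text \<open>
  Since \<open>\<Gamma>\<close> has a face of dimension \<open>d - 1\<close>, it is enough to show that the product of the shifts
  is smaller than \<open>(n - d)!\<close>, that is, that on average the \<open>i\<close>-th shift is smaller than \<open>i\<close>. The generators
  of the Stanley-Reisner ideal are the minimal non-faces, and the \<open>i\<close>-th shift is at most \<open>card W\<close> as
  soon as the vertex set \<open>W\<close> contains \<open>i\<close> of them. All faces have at most \<open>d\<close> vertices, so a large
  vertex set is forced to contain many minimal non-faces, just as in Turan's theorem a graph with
  small independence number is forced to have many edges.

  Quantitatively, a maximal face \<open>F\<close> inside \<open>W\<close> yields a minimal non-face \<open>N \<subseteq> insert v F\<close> through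
  every \<open>v \<in> W - F\<close>. These meet \<open>F\<close>, so they are new compared with the minimal non-faces inside
  \<open>W - F\<close>, where the argument can be repeated. As \<open>card F \<le> d\<close>, after \<open>k\<close> rounds \<open>W\<close> is known to contain at least
  \<open>(card W - d) + (card W - 2 d) + \<dots> + (card W - k d)\<close> minimal non-faces
  (\<open>minimal_nonfaces_lower_bound\<close>). Six rounds with \<open>card W = 7 d\<close> give \<open>6 d + 5 d + \<dots> + d = 21 d\<close>, hence
  the shifts up to index \<open>21 d\<close> are at most \<open>7 d\<close>; two rounds with \<open>card W = i \<ge> 3 d\<close> give \<open>2 i - 3 d \<ge> i\<close>, hence the
  later shifts are at most their index. So the theorem reduces to \<open>(7 d)^(21 d) < (21 d)!\<close>, which is
  the estimate \<open>(k/3)^k < k!\<close> coming from \<open>exp 1 \<le> 3\<close>.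
\<close>

section \<open>Vertex sets contain many minimal non-faces\<close>

definition minimal_nonfaces :: "'a set set \<Rightarrow> 'a set \<Rightarrow> 'a set set" where
  "minimal_nonfaces \<Gamma> W = {N. N \<subseteq> W \<and> N \<notin> \<Gamma> \<and> (\<forall>G. G \<subset> N \<longrightarrow> G \<in> \<Gamma>)}"

lemma finite_minimal_nonfaces: "finite W \<Longrightarrow> finite (minimal_nonfaces \<Gamma> W)"
  by (rule finite_subset[of _ "Pow W"]) (auto simp: minimal_nonfaces_def)

lemma minimal_nonfaces_mono: "V \<subseteq> W \<Longrightarrow> minimal_nonfaces \<Gamma> V \<subseteq> minimal_nonfaces \<Gamma> W"
  by (auto simp: minimal_nonfaces_def)

lemma minimal_nonfaces_nonempty:
  assumes "finite A" "A \<notin> \<Gamma>"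
  shows "\<exists>N. N \<in> minimal_nonfaces \<Gamma> A"
proof -
  let ?S = "{G. G \<subseteq> A \<and> G \<notin> \<Gamma>}"
  have "finite ?S"
    by (rule finite_subset[of _ "Pow A"]) (use assms in auto)
  then obtain N where "N \<in> ?S" "\<forall>G\<in>?S. G \<subseteq> N \<longrightarrow> N = G"
    using finite_has_minimal2[of ?S A] assms by auto
  then have "N \<in> minimal_nonfaces \<Gamma> A"
    unfolding minimal_nonfaces_def by blast
  then show ?thesis ..
qed

text \<open>One round of the counting argument. Because \<open>F\<close> is a face, a minimal non-face inside \<open>insert v F\<close>
  contains \<open>v\<close>, which makes it determine \<open>v\<close>; because \<open>{v}\<close> is a face, it also meets \<open>F\<close>, which
  separates it from the minimal non-faces inside \<open>W - F\<close>.\<close>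

lemma card_minimal_nonfaces_peel:
  assumes W: "finite W"
    and down: "\<And>G H. G \<in> \<Gamma> \<Longrightarrow> H \<subseteq> G \<Longrightarrow> H \<in> \<Gamma>"
    and vertices: "\<And>v. v \<in> W \<Longrightarrow> {v} \<in> \<Gamma>"
    and F: "F \<subseteq> W" "F \<in> \<Gamma>"
    and maximal: "\<And>v. v \<in> W - F \<Longrightarrow> insert v F \<notin> \<Gamma>"
  shows "card (W - F) + card (minimal_nonfaces \<Gamma> (W - F)) \<le> card (minimal_nonfaces \<Gamma> W)"
proof -
  have "\<exists>N. N \<in> minimal_nonfaces \<Gamma> (insert v F)" if "v \<in> W - F" for v
    using minimal_nonfaces_nonempty[of "insert v F" \<Gamma>] maximal[OF that] finite_subset[OF F(1) W]
    by simp
  then obtain N where N: "\<And>v. v \<in> W - F \<Longrightarrow> N v \<in> minimal_nonfaces \<Gamma> (insert v F)"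
    by metis
  have N_minus: "N v - F = {v}" if v: "v \<in> W - F" for v
  proof -
    have "N v \<subseteq> insert v F" "N v \<notin> \<Gamma>"
      using N[OF v] by (auto simp: minimal_nonfaces_def)
    then show ?thesis
      using down[OF F(2), of "N v"] v by blast
  qed
  have N_meets: "N v \<inter> F \<noteq> {}" if v: "v \<in> W - F" for v
  proof
    assume "N v \<inter> F = {}"
    then have "N v = {v}" using N_minus[OF v] by blast
    then show False
      using vertices[of v] v N[OF v] by (simp add: minimal_nonfaces_def)
  qed
  have "inj_on N (W - F)"
    by (rule inj_onI) (metis N_minus singleton_inject)
  then have "card (N ` (W - F)) = card (W - F)"
    by (rule card_image)
  moreover have "N ` (W - F) \<inter> minimal_nonfaces \<Gamma> (W - F) = {}"
    using N_meets by (fastforce simp: minimal_nonfaces_def)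
  moreover have "N ` (W - F) \<union> minimal_nonfaces \<Gamma> (W - F) \<subseteq> minimal_nonfaces \<Gamma> W"
    using N minimal_nonfaces_mono[of "insert _ F" W \<Gamma>] minimal_nonfaces_mono[of "W - F" W \<Gamma>] F(1)
    by blast
  ultimately show ?thesis
    using W card_Un_disjoint[of "N ` (W - F)" "minimal_nonfaces \<Gamma> (W - F)"]
      card_mono[OF finite_minimal_nonfaces[OF W], of "N ` (W - F) \<union> minimal_nonfaces \<Gamma> (W - F)" \<Gamma>]
    by (simp add: finite_minimal_nonfaces)
qed

text \<open>For graphs (\<open>\<Gamma>\<close> the complex of independent sets) and \<open>k\<close> large this is Turan's bound on
  the number of edges when the independence number is at most \<open>d\<close>.\<close>

lemma minimal_nonfaces_lower_bound:
  assumes "finite W"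
    and down: "\<And>G H. G \<in> \<Gamma> \<Longrightarrow> H \<subseteq> G \<Longrightarrow> H \<in> \<Gamma>"
    and "\<And>v. v \<in> W \<Longrightarrow> {v} \<in> \<Gamma>"
    and "\<And>F. F \<in> \<Gamma> \<Longrightarrow> F \<subseteq> W \<Longrightarrow> card F \<le> d"
  shows "(\<Sum>j = 1..k. card W - j * d) \<le> card (minimal_nonfaces \<Gamma> W)"
  using assms(1,3,4)
proof (induction k arbitrary: W)
  case 0
  then show ?case by simp
next
  case (Suc k)
  show ?case
  proof (cases "W = {}")
    case True
    then show ?thesis by simp
  next
    case False
    then obtain w where "w \<in> W" by blast
    then have "{} \<in> \<Gamma>" using Suc.prems(2) down by blast
    let ?S = "{G. G \<subseteq> W \<and> G \<in> \<Gamma>}"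
    have "finite ?S"
      by (rule finite_subset[of _ "Pow W"]) (use Suc.prems(1) in auto)
    then obtain F where F: "F \<in> ?S" and max: "\<forall>G\<in>?S. F \<subseteq> G \<longrightarrow> F = G"
      using finite_has_maximal[of ?S] \<open>{} \<in> \<Gamma>\<close> by blast
    have "insert v F \<notin> \<Gamma>" if "v \<in> W - F" for v
      using max F that by blast
    then have peel: "card (W - F) + card (minimal_nonfaces \<Gamma> (W - F)) \<le> card (minimal_nonfaces \<Gamma> W)"
      using card_minimal_nonfaces_peel[of W \<Gamma> F] Suc.prems down F by blast
    have IH: "(\<Sum>j = 1..k. card (W - F) - j * d) \<le> card (minimal_nonfaces \<Gamma> (W - F))"
      using Suc.IH[of "W - F"] Suc.prems by blast
    have rest: "card W - d \<le> card (W - F)"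
      using F Suc.prems(3)[of F] diff_card_le_card_Diff[of F W] finite_subset[OF _ Suc.prems(1), of F]
      by (auto intro: le_trans[OF diff_le_mono2])
    have "(\<Sum>j = 1..Suc k. card W - j * d) = (card W - d) + (\<Sum>j = 1..k. card W - Suc j * d)"
      using sum.shift_bounds_cl_Suc_ivl[of "\<lambda>j. card W - j * d" 1 k]
      by (simp add: sum.atLeast_Suc_atMost del: sum.cl_ivl_Suc)
    also have "\<dots> \<le> card (W - F) + (\<Sum>j = 1..k. card (W - F) - j * d)"
    proof (intro add_mono sum_mono rest)
      fix j
      show "card W - Suc j * d \<le> card (W - F) - j * d"
        using rest by simp
    qed
    finally show ?thesis using IH peel by linarith
  qed
qed

section \<open>Bounding the minimal Taylor shifts\<close>

lemma inj_on_squarefree_expo: "(\<And>F. F \<in> A \<Longrightarrow> finite F) \<Longrightarrow> inj_on squarefree_expo A"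
  by (rule inj_onI) (metis squarefree_expo_dvd_iff expo_dvd_refl subset_antisym)

lemma squarefree_expo_in_expos:
  assumes "F \<subseteq> {1..n}"
  shows "squarefree_expo F \<in> expos n"
proof -
  have "finite F" using assms finite_subset by blast
  then show ?thesis
    using assms by (auto simp: expos_def in_keys_iff lookup_squarefree_expo split: if_splits)
qed

lemma expo_deg_squarefree_expo:
  assumes "F \<subseteq> {1..n}"
  shows "expo_deg (squarefree_expo F) = card F"
proof -
  have "finite F" using assms finite_subset by blast
  then show ?thesis
    using assms by (simp add: expo_deg_expos[OF squarefree_expo_in_expos[OF assms]]
        lookup_squarefree_expo sum.If_cases Int_absorb1)
qed

text \<open>The squarefree monomial with support \<open>W\<close> is a common multiple of all the generators supported in
  \<open>W\<close>, so its degree bounds the degree of the least common multiple of any \<open>i\<close> of them.\<close>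

lemma taylor_min_shift_le_card:
  fixes \<Gamma> :: "nat set set"
  assumes W: "W \<subseteq> {1..n}" and i: "i \<le> card (minimal_nonfaces \<Gamma> W)"
  shows "taylor_min_shift n (stanley_reisner_ideal n \<Gamma> :: ('k::field) poly_nat set) i \<le> card W"
proof -
  let ?G = "GEN n (stanley_reisner_ideal n \<Gamma> :: 'k poly_nat set)"
  have finW: "finite W" using W finite_subset by blast
  have G: "?G = squarefree_expo ` minimal_nonfaces \<Gamma> {1..n}"
    unfolding GEN_stanley_reisner_ideal minimal_nonfaces_def ..
  obtain M where M: "M \<subseteq> minimal_nonfaces \<Gamma> W" "card M = i"
    using obtain_subset_with_card_n[OF i] by blast
  have M_sub: "F \<subseteq> W" if "F \<in> M" for F
    using that M by (auto simp: minimal_nonfaces_def)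
  have M_fin: "finite F" if "F \<in> M" for F
    using M_sub[OF that] finW finite_subset by blast
  have finM: "finite M"
    using M(1) finite_minimal_nonfaces[OF finW] finite_subset by blast
  let ?T = "squarefree_expo ` M"
  have T: "?T \<subseteq> ?G" "card ?T = i"
    unfolding G using M minimal_nonfaces_mono[OF W, of \<Gamma>]
      card_image[OF inj_on_squarefree_expo, of M] M_fin by blast+
  have "expo_dvd (expo_lcm ?T) (squarefree_expo W)"
    using M_sub M_fin finM finW by (auto simp: expo_lcm_dvd_iff squarefree_expo_dvd_iff)
  then have deg: "expo_deg (expo_lcm ?T) \<le> card W"
    using expo_dvd_deg_less[OF squarefree_expo_in_expos[OF W], of "expo_lcm ?T"]
      expo_deg_squarefree_expo[OF W] by (cases "expo_lcm ?T = squarefree_expo W") auto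
  have "finite ?G" unfolding G by (simp add: finite_minimal_nonfaces)
  then have "finite ((\<lambda>T. expo_deg (expo_lcm T)) ` Pow ?G)" by simp
  then have "finite {expo_deg (expo_lcm T) |T. T \<subseteq> ?G \<and> card T = i}"
    by (rule rev_finite_subset) auto
  then have "taylor_min_shift n (stanley_reisner_ideal n \<Gamma> :: 'k poly_nat set) i \<le> expo_deg (expo_lcm ?T)"
    unfolding taylor_min_shift_def using T by (intro Min_le) blast+
  then show ?thesis using deg by linarith
qed

lemma taylor_min_shift_le:
  fixes \<Gamma> :: "nat set set"
  assumes \<Gamma>: "simplicial_complex_on n \<Gamma>"
    and faces: "\<And>F. F \<in> \<Gamma> \<Longrightarrow> card F \<le> d"
    and "w \<le> n" "i \<le> (\<Sum>j = 1..k. w - j * d)"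
  shows "taylor_min_shift n (stanley_reisner_ideal n \<Gamma> :: ('k::field) poly_nat set) i \<le> w"
proof -
  have down: "H \<in> \<Gamma>" if "G \<in> \<Gamma>" "H \<subseteq> G" for G H
    using \<Gamma> that unfolding simplicial_complex_on_def by blast
  have sub: "{1..w} \<subseteq> {1..n}" using assms(3) by simp
  then have vertices: "{v} \<in> \<Gamma>" if "v \<in> {1..w}" for v
    using \<Gamma> that unfolding simplicial_complex_on_def by blast
  have "(\<Sum>j = 1..k. card {1..w} - j * d) \<le> card (minimal_nonfaces \<Gamma> {1..w})"
    by (rule minimal_nonfaces_lower_bound) (use down vertices faces in auto)
  then show ?thesis
    using taylor_min_shift_le_card[OF sub, of i \<Gamma>, where 'k='k] assms(4) by simp
qed

section \<open>Comparing the product of the shifts with a factorial\<close>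

text \<open>The terms of index \<open>0\<close> and \<open>k\<close> of the exponential series at \<open>k\<close> give \<open>k^k / k! < exp k \<le> 3^k\<close>.\<close>

lemma power_third_less_fact:
  assumes "k > 0"
  shows "(real k / 3) ^ k < fact k"
proof -
  have "(\<Sum>j\<in>{0, k}. inverse (fact j) * real k ^ j) \<le> exp (real k)"
    unfolding exp_def using summable_exp[of "real k"]
    by (intro order.trans[OF sum_le_suminf]) (auto simp: scaleR_conv_of_real)
  then have "1 + real k ^ k / fact k \<le> exp (real k)"
    using assms by (simp add: field_simps)
  also have "exp (real k) = exp 1 ^ k"
    by (simp add: exp_of_nat_mult[symmetric])
  also have "\<dots> \<le> 3 ^ k"
    by (intro power_mono exp_le) simp
  finally have "real k ^ k / fact k < 3 ^ k" by simp
  then show ?thesis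
    by (simp add: power_divide field_simps)
qed

lemma complex_dim_faces:
  assumes \<Gamma>: "simplicial_complex_on n \<Gamma>" "n > 0"
    and dim: "complex_dim \<Gamma> = int d - 1"
  shows "\<And>F. F \<in> \<Gamma> \<Longrightarrow> card F \<le> d" and "d > 0" and "face_number (int d - 1) \<Gamma> > 0"
proof -
  have fin: "finite \<Gamma>"
    by (rule finite_subset[of _ "Pow {1..n}"]) (use \<Gamma> in \<open>auto simp: simplicial_complex_on_def\<close>)
  have "{1} \<in> \<Gamma>" using \<Gamma> by (simp add: simplicial_complex_on_def)
  show le: "card F \<le> d" if "F \<in> \<Gamma>" for F
  proof -
    have "face_dim F \<le> complex_dim \<Gamma>"
      unfolding complex_dim_def using fin that by simp
    then show ?thesis by (simp add: dim face_dim_def)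
  qed
  show "d > 0" using le[OF \<open>{1} \<in> \<Gamma>\<close>] by simp
  have "complex_dim \<Gamma> \<in> face_dim ` \<Gamma>"
    unfolding complex_dim_def using fin \<open>{1} \<in> \<Gamma>\<close> by (intro Max_in) auto
  then show "face_number (int d - 1) \<Gamma> > 0"
    using fin dim by (auto simp: face_number_def card_gt_0_iff)
qed

text \<open>The bound \<open>7 d\<close> exceeds the index for small \<open>i\<close>, but over the first \<open>21 d\<close> indices it is small enough on
  average; afterwards every shift is at most its index.\<close>

lemma prod_taylor_min_shift_less_fact:
  fixes \<Gamma> :: "nat set set"
  assumes \<Gamma>: "simplicial_complex_on n \<Gamma>" and faces: "\<And>F. F \<in> \<Gamma> \<Longrightarrow> card F \<le> d"
    and d: "d > 0" and c: "21 * d \<le> c" "c \<le> n"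
  shows "(\<Prod>i = 1..c. real (taylor_min_shift n (stanley_reisner_ideal n \<Gamma> :: ('k::field) poly_nat set) i))
    < fact c"
proof -
  let ?m = "\<lambda>i. real (taylor_min_shift n (stanley_reisner_ideal n \<Gamma> :: 'k poly_nat set) i)"
  have small: "?m i \<le> 7 * real d" if "i \<le> 21 * d" for i
    using taylor_min_shift_le[OF \<Gamma> faces, of "7 * d" i 6, where 'k='k] that c
    by (simp add: numeral_eq_Suc)
  have large: "?m i \<le> real i" if "3 * d \<le> i" "i \<le> n" for i
    using taylor_min_shift_le[OF \<Gamma> faces, of i i 2, where 'k='k] that
    by (simp add: numeral_eq_Suc)
  have "(\<Prod>i = 1..c. ?m i) = (\<Prod>i = 1..21 * d. ?m i) * (\<Prod>i = 21 * d + 1..c. ?m i)"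
    using prod.ub_add_nat[of 1 "21 * d" ?m "c - 21 * d"] c by simp
  also have "\<dots> \<le> (\<Prod>i = 1..21 * d. 7 * real d) * (\<Prod>i = 21 * d + 1..c. real i)"
    by (intro mult_mono prod_mono prod_nonneg) (use small large c in auto)
  also have "\<dots> = (real (21 * d) / 3) ^ (21 * d) * (\<Prod>i = 21 * d + 1..c. real i)"
    by simp
  also have "\<dots> < fact (21 * d) * (\<Prod>i = 21 * d + 1..c. real i)"
    by (intro mult_strict_right_mono power_third_less_fact prod_pos) (use d in auto)
  also have "\<dots> = (\<Prod>i = 1..21 * d. real i) * (\<Prod>i = 21 * d + 1..c. real i)"
    by (simp add: fact_prod)
  also have "\<dots> = fact c"
    using prod.ub_add_nat[of 1 "21 * d" real "c - 21 * d"] c by (simp add: fact_prod)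
  finally show ?thesis .
qed

theorem theorem5p1:
  fixes \<Gamma> :: "nat set set" and n d :: nat
  assumes "simplicial_complex_on n \<Gamma>"
    and "complex_dim \<Gamma> = int d - 1"
    and "n > 24 * d + 3"
  shows "real (face_number (int d - 1) \<Gamma>) >
    1 / fact (n - d) *
      (\<Prod>i = 1..n - d.
        real (taylor_min_shift n (stanley_reisner_ideal n \<Gamma> :: ('k::field) poly_nat set) i))"
proof -
  have "n > 0" using assms(3) by simp
  note dim = complex_dim_faces[OF assms(1) this assms(2)]
  have "(\<Prod>i = 1..n - d.
        real (taylor_min_shift n (stanley_reisner_ideal n \<Gamma> :: 'k poly_nat set) i)) < fact (n - d)"
    by (rule prod_taylor_min_shift_less_fact[OF assms(1) dim(1,2)]) (use assms(3) in auto)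
  then have "1 / fact (n - d) * (\<Prod>i = 1..n - d.
        real (taylor_min_shift n (stanley_reisner_ideal n \<Gamma> :: 'k poly_nat set) i)) < 1"
    by simp
  also have "1 \<le> real (face_number (int d - 1) \<Gamma>)"
    using dim(3) by simp
  finally show ?thesis .
qed

end
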